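(* Let $m$ and $d$ be integers with $1 \leq m \leq d$, let $k \geq 2$ be an integer, and let $\varepsilon \in (0, 1/\sqrt{d})$. If $F \subset \mathbb{R}^d$ is a non-empty set such that there exists an orientation $\mathbf{e} = \{e_1,\dots,e_m\}$ for which $F$ does not contain any $(k,\varepsilon,\mathbf{e})$-APs, then $$\dim_{\mathrm{A}} F \leq d + \frac{\log(1-1/k^m)}{\log\left(k \lceil \sqrt{d}/(2\varepsilon) \rceil\right)}.$$
   Context: An orientation $\mathbf{e} = \{e_1,\dots,e_m\}$ is a set of $m$ pairwise orthogonal unit vectors in $\mathbb{R}^d$, where $1 \le m \le d$. A set $P \subseteq \mathbb{R}^d$ is an arithmetic patch with orientation $\mathbf{e}$, of size $k$ and gap length $\Delta>0$, if $$P = \left\{ t + \Delta \sum_{i=1}^m x_i e_i : x_i = 0,\dots,k-1 \right\}$$ for some $t \in \mathbb{R}^d$ (the $x_i$ ranging independently over the integers $0,\dots,k-1$, so $P$ has $k^m$ points). For an integer $k \geq 2$, $\varepsilon \geq 0$ and an orientation $\mathbf{e}$, a set $F \subseteq \mathbb{R}^d$ contains a $(k,\varepsilon,\mathbf{e})$-AP if there exists an arithmetic patch $P$ with orientation $\mathbf{e}$, size $k$ and some gap length $\Delta>0$ such that $$\sup_{x \in P} \inf_{y \in F} |x-y| \leq \varepsilon \Delta.$$ For a real number $x \ge 0$, $\lceil x \rceil$ is the smallest integer greater than or equal to $x$. For a non-empty bounded set $E \subset \mathbb{R}^d$ and $r>0$, $N(E,r)$ denotes the smallest number of open sets of diameter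 at most $r$ required to cover $E$. The Assouad dimension of a non-empty set $F \subseteq \mathbb{R}^d$ is $$\dim_{\mathrm{A}} F = \inf\left\{ s \geq 0 : (\exists C>0)(\forall R>0)(\forall r \in (0,R))(\forall x \in F)\ N(B(x,R)\cap F, r) \leq C \left(\frac{R}{r}\right)^s \right\},$$ where $B(x,R)$ is the closed ball with centre $x$ and radius $R$. *)

theory Defs
  imports "HOL-Analysis.Analysis"
begin

definition orientation :: "nat \<Rightarrow> (real ^ 'd) set \<Rightarrow> bool" where
  "orientation m E \<longleftrightarrow>
     finite E \<and> card E = m \<and> (\<forall>e\<in>E. norm e = 1) \<and> pairwise orthogonal E"

text \<open>The coefficients are indexed by the vectors of the orientation themselves,
  so no enumeration of \<open>E\<close> has to be chosen.\<close>

definition arithmetic_patch ::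
    "(real ^ 'd) set \<Rightarrow> nat \<Rightarrow> real \<Rightarrow> (real ^ 'd) set \<Rightarrow> bool" where
  "arithmetic_patch E k \<Delta> P \<longleftrightarrow>
     \<Delta> > 0 \<and>
     (\<exists>t. P = {t + \<Delta> *\<^sub>R (\<Sum>e\<in>E. real (x e) *\<^sub>R e) | x :: real ^ 'd \<Rightarrow> nat.
               \<forall>e\<in>E. x e \<in> {0..<k}})"

text \<open>The supremum and infimum are taken in \<open>ereal\<close>, so that the infimum over an empty
  set \<open>F\<close> is \<open>\<infinity>\<close>.\<close>

definition contains_AP ::
    "nat \<Rightarrow> real \<Rightarrow> (real ^ 'd) set \<Rightarrow> (real ^ 'd) set \<Rightarrow> bool" where
  "contains_AP k \<epsilon> E F \<longleftrightarrow>
     (\<exists>\<Delta> P. arithmetic_patch E k \<Delta> P \<and>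
        (SUP x\<in>P. INF y\<in>F. ereal (norm (x - y))) \<le> ereal (\<epsilon> * \<Delta>))"

text \<open>The covering sets are required to be bounded because \<open>diameter\<close> has no
  meaningful value on unbounded sets.  The least number exists for bounded \<open>E\<close> and \<open>r > 0\<close>,
  which are the only arguments used below.\<close>

definition covering_number :: "(real ^ 'd) set \<Rightarrow> real \<Rightarrow> nat" where
  "covering_number E r =
     (LEAST n. \<exists>\<U>. finite \<U> \<and> card \<U> = n \<and>
        (\<forall>U\<in>\<U>. open U \<and> bounded U \<and> diameter U \<le> r) \<and> E \<subseteq> \<Union>\<U>)"

definition assouad_dim :: "(real ^ 'd) set \<Rightarrow> ereal" where
  "assouad_dim F =
     Inf {ereal s | s. s \<ge> 0 \<and>
       (\<exists>C>0. \<forall>R>0. \<forall>r\<in>{0<..<R}. \<forall>x\<in>F.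
          real (covering_number (cball x R \<inter> F) r) \<le> C * (R / r) powr s)}"

end

theory Submission
  imports Defs
begin

text \<open>Extend the orientation to an orthonormal basis and put
  \<open>N = \<lceil>\<surd>d / (2\<epsilon>)\<rceil>\<close>, \<open>q = kN\<close>.  Split a cube of side \<open>l\<close>, aligned with this basis, into \<open>q ^ d\<close>
  subcubes.  The centres of \<open>k ^ m\<close> subcubes whose indices agree modulo \<open>N\<close> in the directions of the
  orientation, and agree exactly in the others, form an arithmetic patch with gap \<open>l / k\<close>.  Every point
  of a subcube is within \<open>\<surd>d l / (2q) \<le> \<epsilon> l / k\<close> of its centre, so at least one subcube of each such class
  misses \<open>F\<close>, and at most \<open>M = q ^ d (1 - 1 / k ^ m)\<close> subcubes meet \<open>F\<close>.  Iterating, \<open>F\<close> meets at most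
  \<open>M ^ n\<close> of the subcubes of side \<open>l / q ^ n\<close>, whence the dimension is at most \<open>log M / log q\<close>.\<close>

section \<open>Orthonormal bases and coordinates\<close>

text \<open>The basis is an unindexed set, as is an orientation, so subcube indices and patch
  coefficients are both functions on basis vectors.\<close>

locale orthonormal_frame =
  fixes B :: "'a::euclidean_space set"
  assumes orthogonal: "pairwise orthogonal B"
    and unit: "\<And>b. b \<in> B \<Longrightarrow> norm b = 1"
    and span: "span B = UNIV"
begin

lemma finite_frame: "finite B"
  using orthogonal by (rule pairwise_orthogonal_imp_finite)

lemma card_frame: "card B = DIM('a)"
proof -
  have "0 \<notin> B" using unit by force
  then have "independent B"
    using orthogonal pairwise_orthogonal_independent by blast
  then show ?thesis
    by (metis dim_UNIV dim_eq_card_independent dim_span span)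
qed

lemma inner_frame: "b \<in> B \<Longrightarrow> c \<in> B \<Longrightarrow> b \<bullet> c = (if b = c then 1 else 0)"
  using orthogonal unit
  by (auto simp: pairwise_def orthogonal_def dot_square_norm)

lemma inner_frame_sum:
  assumes "b \<in> B"
  shows "(\<Sum>c\<in>B. f c *\<^sub>R c) \<bullet> b = f b"
proof -
  have "(\<Sum>c\<in>B. f c *\<^sub>R c) \<bullet> b = (\<Sum>c\<in>B. if c = b then f c else 0)"
    unfolding inner_sum_left by (rule sum.cong) (auto simp: inner_frame assms)
  then show ?thesis using finite_frame assms by simp
qed

text \<open>Pythagoras: the squared norm is a sum of \<open>DIM('a)\<close> squared coordinates.
  Every factor \<surd>d below comes from here.\<close>

lemma norm_le_frame:
  assumes "\<And>b. b \<in> B \<Longrightarrow> \<bar>v \<bullet> b\<bar> \<le> c" and "c \<ge> 0"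
  shows "norm v \<le> sqrt (real DIM('a)) * c"
proof -
  have "v = (\<Sum>b\<in>B. (v \<bullet> b) *\<^sub>R b)"
    using orthonormal_basis_expand[OF orthogonal unit _ finite_frame] span by simp
  then have "(norm v)\<^sup>2 = (norm (\<Sum>b\<in>B. (v \<bullet> b) *\<^sub>R b))\<^sup>2" by simp
  also have "\<dots> = (\<Sum>b\<in>B. (norm ((v \<bullet> b) *\<^sub>R b))\<^sup>2)"
    using orthogonal
    by (intro norm_sum_Pythagorean finite_frame)
      (auto simp: pairwise_def orthogonal_def)
  also have "\<dots> = (\<Sum>b\<in>B. (v \<bullet> b)\<^sup>2)"
    by (rule sum.cong) (auto simp: unit)
  also have "\<dots> \<le> (\<Sum>b\<in>B. c\<^sup>2)"
    using assms by (intro sum_mono) (simp add: abs_le_square_iff[symmetric])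
  also have "\<dots> = (sqrt (real DIM('a)) * c)\<^sup>2"
    by (simp add: card_frame power_mult_distrib)
  finally show ?thesis
    by (rule power2_le_imp_le) (use assms in simp)
qed

section \<open>Half-open cubes and their subdivision\<close>

text \<open>The strict upper bound keeps the floor of a rescaled coordinate below \<open>q\<close>
  when a cube is subdivided.\<close>

definition cube :: "'a \<Rightarrow> real \<Rightarrow> 'a set" where
  "cube t l = {y. \<forall>b\<in>B. 0 \<le> (y - t) \<bullet> b \<and> (y - t) \<bullet> b < l}"

text \<open>Here \<open>l\<close> is the side of the small cubes, not of the cube being
  divided.\<close>

definition subcorner :: "'a \<Rightarrow> real \<Rightarrow> ('a \<Rightarrow> nat) \<Rightarrow> 'a" where
  "subcorner t l j = t + l *\<^sub>R (\<Sum>b\<in>B. real (j b) *\<^sub>R b)"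

text \<open>Coverings need open sets; the factor 2 turns the bound \<surd>d l on the distance into a
  strict one.\<close>

lemma cube_subset_ball:
  assumes "l > 0"
  shows "cube t l \<subseteq> ball t (2 * sqrt (real DIM('a)) * l)"
proof
  fix y assume "y \<in> cube t l"
  then have "norm (y - t) \<le> sqrt (real DIM('a)) * l"
    using assms by (intro norm_le_frame) (auto simp: cube_def)
  also have "\<dots> < 2 * sqrt (real DIM('a)) * l" using assms by simp
  finally show "y \<in> ball t (2 * sqrt (real DIM('a)) * l)"
    by (simp add: dist_norm norm_minus_commute)
qed

text \<open>The corner lies \<open>R\<close> below \<open>x\<close> in every coordinate. Side
  \<open>2 * R\<close> would lose points with a coordinate exactly \<open>R\<close> above
  \<open>x\<close>, since cubes are half-open.\<close>

lemma cball_subset_cube: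
  assumes "R > 0"
  shows "cball x R \<subseteq> cube (x - R *\<^sub>R (\<Sum>b\<in>B. b)) (3 * R)"
proof
  fix y assume "y \<in> cball x R"
  then have y: "norm (y - x) \<le> R" by (simp add: dist_norm norm_minus_commute)
  show "y \<in> cube (x - R *\<^sub>R (\<Sum>b\<in>B. b)) (3 * R)"
    unfolding cube_def
  proof (intro CollectI ballI)
    fix b assume b: "b \<in> B"
    have "\<bar>(y - x) \<bullet> b\<bar> \<le> R"
      using Cauchy_Schwarz_ineq2[of "y - x" b] unit[OF b] y by simp
    moreover have "(\<Sum>b\<in>B. b) \<bullet> b = 1"
      using inner_frame_sum[OF b, of "\<lambda>_. 1"] by simp
    ultimately show "0 \<le> (y - (x - R *\<^sub>R (\<Sum>b\<in>B. b))) \<bullet> b \<and>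
        (y - (x - R *\<^sub>R (\<Sum>b\<in>B. b))) \<bullet> b < 3 * R"
      using assms by (auto simp: inner_diff_left inner_simps)
  qed
qed

lemma cube_subdivide:
  fixes q :: nat
  assumes y: "y \<in> cube t l" and "l > 0" "q > 0"
  shows "\<exists>j\<in>B \<rightarrow>\<^sub>E {..<q}. y \<in> cube (subcorner t (l / q) j) (l / q)"
proof
  \<comment> \<open>The index counts whole steps of length \<open>l / q\<close> from the corner;
    \<open>restrict\<close> puts it into the finite set of extensional functions.\<close>
  define j where "j = restrict (\<lambda>b. nat \<lfloor>(y - t) \<bullet> b * q / l\<rfloor>) B"
  have coord: "0 \<le> (y - t) \<bullet> b" "(y - t) \<bullet> b < l" if "b \<in> B" for b
    using y that by (auto simp: cube_def)
  show "j \<in> B \<rightarrow>\<^sub>E {..<q}"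
  proof (rule PiE_I)
    fix b assume b: "b \<in> B"
    have "(y - t) \<bullet> b * q / l < q"
      using coord[OF b] assms by (simp add: field_simps)
    moreover have "0 \<le> (y - t) \<bullet> b * q / l"
      using coord[OF b] assms by simp
    ultimately have "nat \<lfloor>(y - t) \<bullet> b * q / l\<rfloor> < q"
      by linarith
    then show "j b \<in> {..<q}" using b by (simp add: j_def)
  qed (simp add: j_def)
  show "y \<in> cube (subcorner t (l / q) j) (l / q)"
    unfolding cube_def
  proof (intro CollectI ballI)
    fix b assume b: "b \<in> B"
    have *: "0 \<le> (y - t) \<bullet> b * q / l"
      using coord[OF b] assms by simp
    have j1: "real (j b) \<le> (y - t) \<bullet> b * q / l" and j2: "(y - t) \<bullet> b * q / l < real (j b) + 1"
      using b * by (simp_all add: j_def)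
    have "(y - subcorner t (l / q) j) \<bullet> b = (y - t) \<bullet> b - l / q * real (j b)"
      using inner_frame_sum[OF b, of "\<lambda>c. real (j c)"]
      by (simp add: subcorner_def inner_simps)
    also have "\<dots> = l / q * ((y - t) \<bullet> b * q / l - real (j b))"
      using assms by (simp add: field_simps)
    finally have eq: "(y - subcorner t (l / q) j) \<bullet> b = l / q * ((y - t) \<bullet> b * q / l - real (j b))" .
    have "l / q > 0" using assms by simp
    then show "0 \<le> (y - subcorner t (l / q) j) \<bullet> b \<and> (y - subcorner t (l / q) j) \<bullet> b < l / q"
      unfolding eq using j1 j2 mult_strict_left_mono[of "(y - t) \<bullet> b * q / l - real (j b)" 1 "l / q"]
        mult_nonneg_nonneg[of "l / q" "(y - t) \<bullet> b * q / l - real (j b)"]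
      by simp
  qed
qed

text \<open>As \<open>few\<close> holds at every position and scale, each refinement multiplies the
  number of cubes by at most \<open>M\<close>.\<close>

lemma iterated_cube_cover:
  fixes q :: nat and F :: "'a set"
  assumes "q > 0" "M \<ge> 0"
    and few: "\<And>t l. l > 0 \<Longrightarrow>
      real (card {j \<in> B \<rightarrow>\<^sub>E {..<q}. cube (subcorner t (l / q) j) (l / q) \<inter> F \<noteq> {}}) \<le> M"
    and "l > 0"
  shows "\<exists>T. finite T \<and> real (card T) \<le> M ^ n \<and> F \<inter> cube t l \<subseteq> (\<Union>u\<in>T. cube u (l / q ^ n))"
proof (induction n)
  case 0
  show ?case by (rule exI[of _ "{t}"]) simp
next
  case (Suc n)
  then obtain T where T: "finite T" "real (card T) \<le> M ^ n"
    "F \<inter> cube t l \<subseteq> (\<Union>u\<in>T. cube u (l / q ^ n))" by blast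
  define h where "h = l / q ^ n"
  have h: "h > 0" "l / q ^ Suc n = h / q" using assms by (simp_all add: h_def)
  define J where "J u = {j \<in> B \<rightarrow>\<^sub>E {..<q}. cube (subcorner u (h / q) j) (h / q) \<inter> F \<noteq> {}}" for u
  have finJ: "finite (J u)" for u
    unfolding J_def using finite_frame by (simp add: finite_PiE)
  \<comment> \<open>Each cube is replaced by those of its subcubes that meet
    \<open>F\<close>.\<close>
  define T' where "T' = (\<Union>u\<in>T. subcorner u (h / q) ` J u)"
  have "card T' \<le> (\<Sum>u\<in>T. card (subcorner u (h / q) ` J u))"
    unfolding T'_def by (rule card_UN_le) fact
  also have "\<dots> \<le> (\<Sum>u\<in>T. card (J u))"
    by (intro sum_mono card_image_le finJ)
  finally have "real (card T') \<le> real (\<Sum>u\<in>T. card (J u))"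
    by (simp only: of_nat_le_iff)
  also have "\<dots> \<le> (\<Sum>u\<in>T. M)"
    unfolding of_nat_sum J_def by (intro sum_mono few h)
  also have "\<dots> \<le> M ^ Suc n"
    using T(2) \<open>M \<ge> 0\<close> by (simp add: mult.commute mult_left_mono)
  finally have "real (card T') \<le> M ^ Suc n" .
  moreover have "F \<inter> cube t l \<subseteq> (\<Union>u\<in>T'. cube u (h / q))"
  proof
    fix y assume y: "y \<in> F \<inter> cube t l"
    then obtain u where u: "u \<in> T" "y \<in> cube u h" using T(3) by (auto simp: h_def)
    obtain j where "j \<in> B \<rightarrow>\<^sub>E {..<q}" "y \<in> cube (subcorner u (h / q) j) (h / q)"
      using cube_subdivide[OF u(2) h(1) \<open>q > 0\<close>] by blast
    with y u show "y \<in> (\<Union>u\<in>T'. cube u (h / q))"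
      by (auto simp: T'_def J_def)
  qed
  moreover have "finite T'" using T(1) finJ by (simp add: T'_def)
  ultimately show ?case unfolding h(2) by blast
qed

section \<open>Counting indices when every residue class has a gap\<close>

text \<open>The function \<open>a\<close> is the representative of a residue class, and \<open>x\<close> selects a member of it.\<close>

lemma card_missing_residue_classes:
  fixes k N :: nat
  assumes "E \<subseteq> B" "k > 0" "N > 0"
    and G: "G \<subseteq> B \<rightarrow>\<^sub>E {..<k * N}"
    and miss: "\<And>a. a \<in> (\<Pi>\<^sub>E b\<in>B. if b \<in> E then {..<N} else {..<k * N}) \<Longrightarrow>
      \<exists>x. (\<forall>e\<in>E. x e < k) \<and> restrict (\<lambda>b. a b + (if b \<in> E then N * x b else 0)) B \<notin> G"
  shows "real (card G) \<le> real (k * N) ^ DIM('a) * (1 - 1 / real k ^ card E)"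
proof -
  define A where "A = (\<Pi>\<^sub>E b\<in>B. if b \<in> E then {..<N} else {..<k * N})"
  obtain x where x: "\<And>a e. a \<in> A \<Longrightarrow> e \<in> E \<Longrightarrow> x a e < k"
    "\<And>a. a \<in> A \<Longrightarrow> restrict (\<lambda>b. a b + (if b \<in> E then N * x a b else 0)) B \<notin> G"
    using miss unfolding A_def[symmetric] by metis
  define f where "f a = restrict (\<lambda>b. a b + (if b \<in> E then N * x a b else 0)) B" for a
  have fB: "f a \<in> (B \<rightarrow>\<^sub>E {..<k * N}) - G" if "a \<in> A" for a
  proof -
    have "f a b < k * N" if b: "b \<in> B" for b
    proof (cases "b \<in> E")
      case True
      then have "a b < N" "x a b < k"
        using \<open>a \<in> A\<close> x(1) b by (auto simp: A_def PiE_iff)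
      then have "a b + N * x a b < N * Suc (x a b)" "N * Suc (x a b) \<le> N * k"
        by (simp, intro mult_le_mono2) simp
      then show ?thesis using True b by (simp add: f_def mult.commute)
    next
      case False
      then have "a b < k * N" using \<open>a \<in> A\<close> b by (auto simp: A_def PiE_iff)
      then show ?thesis using False b by (simp add: f_def)
    qed
    then show ?thesis using x(2)[OF that] by (auto simp: f_def)
  qed
  \<comment> \<open>The missing index \<open>f a\<close> determines \<open>a\<close>: by its
    residues modulo \<open>N\<close> along \<open>E\<close>, and by its own values elsewhere. So
    \<open>G\<close> misses at least \<open>card A\<close> indices.\<close>
  have "inj_on f A"
  proof (rule inj_onI)
    fix a a' assume aa: "a \<in> A" "a' \<in> A" "f a = f a'"
    show "a = a'"
    proof (rule PiE_ext)
      show "a \<in> (\<Pi>\<^sub>E b\<in>B. if b \<in> E then {..<N} else {..<k * N})"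
        "a' \<in> (\<Pi>\<^sub>E b\<in>B. if b \<in> E then {..<N} else {..<k * N})"
        using aa by (simp_all add: A_def)
      fix b assume b: "b \<in> B"
      have eq: "f a b = f a' b" using aa by simp
      show "a b = a' b"
      proof (cases "b \<in> E")
        case True
        then have "a b < N" "a' b < N"
          using aa b by (auto simp: A_def PiE_iff)
        moreover have "(a b + N * x a b) mod N = (a' b + N * x a' b) mod N"
          using eq True b by (simp add: f_def)
        ultimately show ?thesis by simp
      qed (use eq b in \<open>simp add: f_def\<close>)
    qed
  qed
  have fin: "finite (B \<rightarrow>\<^sub>E {..<k * N})" using finite_frame by (simp add: finite_PiE)
  have "card A = card (f ` A)" using \<open>inj_on f A\<close> by (simp add: card_image)
  also have "\<dots> \<le> card ((B \<rightarrow>\<^sub>E {..<k * N}) - G)"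
    using fB fin by (intro card_mono) auto
  also have "\<dots> = (k * N) ^ DIM('a) - card G"
    using G fin finite_frame
    by (subst card_Diff_subset) (auto intro: finite_subset simp: card_PiE card_frame)
  finally have le: "card A \<le> (k * N) ^ DIM('a) - card G" .
  \<comment> \<open>This excludes truncation in the natural-number subtraction above.\<close>
  have "card G \<le> (k * N) ^ DIM('a)"
    using card_mono[OF fin G] finite_frame by (simp add: card_PiE card_frame)
  with le have sum_le: "real (card A) + real (card G) \<le> real (k * N) ^ DIM('a)"
    by (metis le_diff_conv2 of_nat_add of_nat_le_iff of_nat_power)
  have "card A = (\<Prod>b\<in>B. if b \<in> E then N else k * N)"
    using finite_frame by (simp add: A_def card_PiE if_distrib cong: if_cong)
  moreover have "(\<Prod>b\<in>B. if b \<in> E then k else 1) = k ^ card E"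
    using finite_frame \<open>E \<subseteq> B\<close> by (simp add: prod.If_cases Int_absorb1)
  \<comment> \<open>An extra factor \<open>k\<close> in each direction of \<open>E\<close> makes all
    factors equal to \<open>k * N\<close>, which gives the number of classes.\<close>
  ultimately have "card A * k ^ card E =
      (\<Prod>b\<in>B. (if b \<in> E then N else k * N) * (if b \<in> E then k else 1))"
    by (simp only: prod.distrib)
  also have "\<dots> = (\<Prod>b\<in>B. k * N)" by (rule prod.cong) auto
  finally have "card A * k ^ card E = (k * N) ^ DIM('a)" by (simp add: card_frame)
  then have "real (card A) * real k ^ card E = real (k * N) ^ DIM('a)"
    by (metis of_nat_mult of_nat_power)
  then have "real (card A) = real (k * N) ^ DIM('a) / real k ^ card E"
    using \<open>k > 0\<close> by (simp add: field_simps)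
  with sum_le show ?thesis by (simp add: algebra_simps)
qed

end

section \<open>Extending an orientation to an orthonormal basis\<close>

text \<open>An orthonormal basis \<open>C\<close> of the orthogonal complement \<open>S\<close> of
  \<open>E\<close> is adjoined to \<open>E\<close>.\<close>

lemma orthonormal_frame_extension:
  fixes E :: "'a::euclidean_space set"
  assumes orthE: "pairwise orthogonal E" and unitE: "\<And>e. e \<in> E \<Longrightarrow> norm e = 1"
  obtains B where "E \<subseteq> B" "orthonormal_frame B"
proof -
  have finE: "finite E" using orthE by (rule pairwise_orthogonal_imp_finite)
  define S where "S = {x. \<forall>e\<in>E. orthogonal e x}"
  have "subspace S" unfolding S_def
    by (simp add: subspace_def orthogonal_clauses)
  then obtain C where C: "C \<subseteq> S" "pairwise orthogonal C" "\<And>x. x \<in> C \<Longrightarrow> norm x = 1" "span C = S"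
    using orthonormal_basis_subspace by metis
  have "pairwise orthogonal (E \<union> C)"
    using orthE C(1,2) unfolding pairwise_def S_def
    by (auto dest: subsetD) (metis (no_types, lifting) mem_Collect_eq orthogonal_commute subsetD)+
  moreover have "x \<in> span (E \<union> C)" for x
  proof -
    \<comment> \<open>The orthogonal projection of \<open>x\<close> to \<open>span E\<close>; the
      remainder \<open>x - p\<close> lies in \<open>S = span C\<close>.\<close>
    define p where "p = (\<Sum>e\<in>E. (x \<bullet> e) *\<^sub>R e)"
    have "p \<in> span E" unfolding p_def by (intro span_sum span_scale span_base)
    have "e \<bullet> (x - p) = 0" if "e \<in> E" for e
    proof -
      have "e \<bullet> p = (\<Sum>c\<in>E. if c = e then x \<bullet> c else 0)"
        unfolding p_def inner_sum_right using orthE that unitE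
        by (intro sum.cong) (auto simp: pairwise_def orthogonal_def dot_square_norm)
      then show ?thesis using finE that by (simp add: inner_diff_right inner_commute)
    qed
    then have "x - p \<in> span C" by (simp add: C S_def orthogonal_def)
    then have "x - p \<in> span (E \<union> C)" "p \<in> span (E \<union> C)"
      using \<open>p \<in> span E\<close> span_mono[of C "E \<union> C"] span_mono[of E "E \<union> C"] by auto
    then show ?thesis using span_add by fastforce
  qed
  ultimately have "orthonormal_frame (E \<union> C)"
    using unitE C(3) by unfold_locales auto
  then show ?thesis by (intro that[of "E \<union> C"]) auto
qed

section \<open>Subcube centres and arithmetic patches\<close>

context orthonormal_frame
begin

text \<open>Adding 1/2 to each index gives the centre, from which each coordinate deviates by at
  most \<open>l / 2\<close>.\<close>

lemma dist_subcube_centre_le: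
  assumes y: "y \<in> cube (subcorner t l j) l" and "l > 0"
  shows "norm (t + l *\<^sub>R (\<Sum>b\<in>B. (real (j b) + 1 / 2) *\<^sub>R b) - y) \<le> sqrt (real DIM('a)) * (l / 2)"
proof (rule norm_le_frame)
  fix b assume b: "b \<in> B"
  have "(t + l *\<^sub>R (\<Sum>b\<in>B. (real (j b) + 1 / 2) *\<^sub>R b) - y) \<bullet> b = l / 2 - (y - subcorner t l j) \<bullet> b"
    using inner_frame_sum[OF b, of "\<lambda>c. real (j c)"]
      inner_frame_sum[OF b, of "\<lambda>c. real (j c) + 1 / 2"]
    by (simp add: subcorner_def inner_simps algebra_simps)
  then show "\<bar>(t + l *\<^sub>R (\<Sum>b\<in>B. (real (j b) + 1 / 2) *\<^sub>R b) - y) \<bullet> b\<bar> \<le> l / 2"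
    using y b unfolding cube_def abs_le_iff by force
qed (use assms in simp)

end

text \<open>If every subcube of one residue class met \<open>F\<close>, their centres would form a
  patch that \<open>F\<close> approximates; so each class has a member missing \<open>F\<close>, and
  the count above applies.\<close>

lemma few_subcubes_meet:
  fixes F :: "(real ^ 'd) set" and k N :: nat
  assumes "orthonormal_frame B" "E \<subseteq> B" "k > 0" "N > 0" "l > 0"
    and noAP: "\<not> contains_AP k \<epsilon> E F"
    and N: "sqrt (real CARD('d)) / (2 * \<epsilon>) \<le> real N" and "\<epsilon> > 0"
  defines "h \<equiv> l / real (k * N)"
  shows "real (card {j \<in> B \<rightarrow>\<^sub>E {..<k * N}.
      orthonormal_frame.cube B (orthonormal_frame.subcorner B t h j) h \<inter> F \<noteq> {}})
    \<le> real (k * N) ^ CARD('d) * (1 - 1 / real k ^ card E)"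
proof -
  interpret orthonormal_frame B by fact
  have h: "h > 0" "real N * h = l / k" using assms by (auto simp: h_def)
  define G where "G = {j \<in> B \<rightarrow>\<^sub>E {..<k * N}. cube (subcorner t h j) h \<inter> F \<noteq> {}}"
  have "real (card G) \<le> real (k * N) ^ DIM(real ^ 'd) * (1 - 1 / real k ^ card E)"
  proof (rule card_missing_residue_classes)
    fix a assume "a \<in> (\<Pi>\<^sub>E b\<in>B. if b \<in> E then {..<N} else {..<k * N})"
    define j where "j x = restrict (\<lambda>b. a b + (if b \<in> E then N * x b else 0)) B" for x
    show "\<exists>x. (\<forall>e\<in>E. x e < k) \<and> j x \<notin> G"
    proof (rule ccontr)
      assume contra: "\<not> ?thesis"
      \<comment> \<open>The base point of the patch is the centre of the subcube with index
        \<open>a\<close>.\<close>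
      define s where "s = t + h *\<^sub>R (\<Sum>b\<in>B. (real (a b) + 1 / 2) *\<^sub>R b)"
      define P where "P = {s + (l / k) *\<^sub>R (\<Sum>e\<in>E. real (x e) *\<^sub>R e) | x. \<forall>e\<in>E. x e \<in> {0..<k}}"
      have "arithmetic_patch E k (l / k) P"
        unfolding arithmetic_patch_def P_def using \<open>l > 0\<close> \<open>k > 0\<close> by auto
      moreover have "(SUP p\<in>P. INF y\<in>F. ereal (norm (p - y))) \<le> ereal (\<epsilon> * (l / k))"
      proof (rule SUP_least)
        fix p assume "p \<in> P"
        then obtain x where p: "p = s + (l / k) *\<^sub>R (\<Sum>e\<in>E. real (x e) *\<^sub>R e)"
          and x: "\<forall>e\<in>E. x e < k" by (auto simp: P_def)
        then obtain y where y: "y \<in> F" "y \<in> cube (subcorner t h (j x)) h"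
          using contra unfolding G_def by blast
        \<comment> \<open>Raising the index by \<open>N * x b\<close> along \<open>b\<close> in
          \<open>E\<close> moves the centre by \<open>N * h * x b\<close>, which is
          \<open>x b\<close> times the gap \<open>l / k\<close>.\<close>
        have "(\<Sum>b\<in>B. (real (j x b) + 1 / 2) *\<^sub>R b) =
            (\<Sum>b\<in>B. (real (a b) + 1 / 2) *\<^sub>R b + (if b \<in> E then (real N * real (x b)) *\<^sub>R b else 0))"
          by (rule sum.cong) (auto simp: j_def algebra_simps)
        also have "\<dots> = (\<Sum>b\<in>B. (real (a b) + 1 / 2) *\<^sub>R b) + (\<Sum>e\<in>E. (real N * real (x e)) *\<^sub>R e)"
          using finite_frame \<open>E \<subseteq> B\<close>
          by (simp add: sum.distrib Int_absorb1 flip: sum.inter_restrict)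
        also have "(\<Sum>e\<in>E. (real N * real (x e)) *\<^sub>R e) = real N *\<^sub>R (\<Sum>e\<in>E. real (x e) *\<^sub>R e)"
          by (simp add: scaleR_sum_right)
        finally have "p = t + h *\<^sub>R (\<Sum>b\<in>B. (real (j x b) + 1 / 2) *\<^sub>R b)"
          unfolding p s_def h(2)[symmetric] by (simp add: scaleR_add_right mult.commute)
        then have "norm (p - y) \<le> sqrt (real CARD('d)) * (h / 2)"
          using dist_subcube_centre_le[OF y(2) h(1)] by simp
        \<comment> \<open>This is where the size of \<open>N\<close> enters: \<surd>d / 2 \<le>
          \<epsilon> \<open>N\<close>.\<close>
        also have "\<dots> \<le> \<epsilon> * (real N * h)"
          using N \<open>\<epsilon> > 0\<close> h(1) by (simp add: field_simps)
        finally have "norm (p - y) \<le> \<epsilon> * (l / k)" unfolding h(2) .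
        then show "(INF y\<in>F. ereal (norm (p - y))) \<le> ereal (\<epsilon> * (l / k))"
          using y(1) by (intro INF_lower2[of y]) auto
      qed
      ultimately show False using noAP unfolding contains_AP_def by blast
    qed
  qed (use assms in \<open>auto simp: G_def\<close>)
  then show ?thesis by (simp add: G_def)
qed

section \<open>From subdivision counts to the Assouad dimension\<close>

lemma covering_number_le:
  assumes "finite \<U>" "\<And>U. U \<in> \<U> \<Longrightarrow> open U \<and> bounded U \<and> diameter U \<le> r" "S \<subseteq> \<Union>\<U>"
  shows "covering_number S r \<le> card \<U>"
  unfolding covering_number_def by (rule Least_le) (use assms in blast)

text \<open>About log(R/r) / log q subdivisions of a cube around the ball reach scale
  \<open>r\<close>, leaving at most \<open>(q powr s) ^ n = (q ^ n) powr s\<close> cubes, which is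
  of order (R/r)^s.\<close>

lemma assouad_dim_le_of_subdivision:
  fixes F :: "(real ^ 'd) set" and q :: nat
  assumes "orthonormal_frame B" "q \<ge> 2" "s \<ge> 0"
    and few: "\<And>t l. l > 0 \<Longrightarrow>
      real (card {j \<in> B \<rightarrow>\<^sub>E {..<q}.
        orthonormal_frame.cube B (orthonormal_frame.subcorner B t (l / q) j) (l / q) \<inter> F \<noteq> {}})
      \<le> real q powr s"
  shows "assouad_dim F \<le> ereal s"
proof -
  interpret orthonormal_frame B by fact
  \<comment> \<open>12 = 3 * 2 * 2: the starting cube has side \<open>3 * R\<close>, a cube of side
    \<open>u\<close> lies in a ball of radius 2 \<surd>d \<open>u\<close>, and the diameter is at
    most twice the radius.\<close>
  define c where "c = 12 * sqrt (real CARD('d))"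
  have "sqrt (real CARD('d)) \<ge> 1" by simp
  then have c: "c > 1" unfolding c_def by linarith
  \<comment> \<open>The factor \<open>c\<close> is the loss in scale, and \<open>q\<close> bounds
    the overshoot of the least \<open>n\<close> chosen below.\<close>
  define C where "C = (real q * c) powr s"
  have "real (covering_number (cball x R \<inter> F) r) \<le> C * (R / r) powr s"
    if "R > 0" "0 < r" "r < R" for R r x
  proof -
    \<comment> \<open>The first level at which the covering balls have diameter at most
      \<open>r\<close>, by the choice of \<open>c\<close>.\<close>
    define n where "n = (LEAST n. c * R / r \<le> real q ^ n)"
    have ex: "\<exists>n. c * R / r \<le> real q ^ n"
      using real_arch_pow[of "real q" "c * R / r"] \<open>q \<ge> 2\<close> by (auto intro: less_imp_le)
    then have n: "c * R / r \<le> real q ^ n" unfolding n_def by (rule LeastI_ex)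
    have "1 < R / r" using that by simp
    then have big: "1 < c * R / r" using c less_1_mult[of c "R / r"] by simp
    \<comment> \<open>Level 0 is too coarse, so \<open>n\<close> has a predecessor; minimality makes
      that fail, which bounds \<open>q ^ n\<close> from above.\<close>
    then have "n \<noteq> 0" using n by (intro notI) simp
    then obtain n' where n': "n = Suc n'" by (cases n) auto
    then have "\<not> c * R / r \<le> real q ^ n'"
      using not_less_Least[of n' "\<lambda>n. c * R / r \<le> real q ^ n"] by (simp add: n_def)
    then have qn: "real q ^ n \<le> real q * c * (R / r)"
      using n' \<open>q \<ge> 2\<close> mult_left_mono[of "real q ^ n'" "c * R / r" "real q"]
      by (simp add: mult.assoc)
    define u where "u = 3 * R / real q ^ n"
    have u: "u > 0" "2 * (2 * sqrt (real CARD('d)) * u) \<le> r"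
    proof -
      show "u > 0" using that \<open>q \<ge> 2\<close> by (simp add: u_def)
      have "c * R \<le> r * real q ^ n" using n that by (simp add: field_simps)
      then show "2 * (2 * sqrt (real CARD('d)) * u) \<le> r"
        using \<open>q \<ge> 2\<close> by (simp add: u_def c_def field_simps)
    qed
    obtain T where T: "finite T" "real (card T) \<le> (real q powr s) ^ n"
      "F \<inter> cube (x - R *\<^sub>R (\<Sum>b\<in>B. b)) (3 * R) \<subseteq> (\<Union>v\<in>T. cube v u)"
      using iterated_cube_cover[OF _ _ few, of "3 * R" n "x - R *\<^sub>R (\<Sum>b\<in>B. b)"] \<open>R > 0\<close> \<open>q \<ge> 2\<close>
      unfolding u_def by auto
    let ?\<rho> = "2 * sqrt (real CARD('d)) * u"
    have "covering_number (cball x R \<inter> F) r \<le> card ((\<lambda>v. ball v ?\<rho>) ` T)"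
    proof (rule covering_number_le)
      show "cball x R \<inter> F \<subseteq> \<Union> ((\<lambda>v. ball v ?\<rho>) ` T)"
        using cball_subset_cube[OF \<open>R > 0\<close>, of x] T(3) cube_subset_ball[OF u(1)] by force
    qed (use T(1) u that in auto)
    also have "\<dots> \<le> card T" using T(1) by (rule card_image_le)
    finally have "real (covering_number (cball x R \<inter> F) r) \<le> (real q powr s) ^ n"
      using T(2) by linarith
    also have "\<dots> = (real q ^ n) powr s"
      using \<open>q \<ge> 2\<close> by (simp add: powr_powr mult.commute flip: powr_realpow)
    also have "\<dots> \<le> (real q * c * (R / r)) powr s"
      using qn \<open>s \<ge> 0\<close> by (intro powr_mono2) auto
    also have "\<dots> = C * (R / r) powr s"
      unfolding C_def by (rule powr_mult)
    finally show ?thesis .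
  qed
  moreover have "C > 0" unfolding C_def using c \<open>q \<ge> 2\<close> by simp
  ultimately show ?thesis
    unfolding assouad_dim_def using \<open>s \<ge> 0\<close> by (intro Inf_lower) auto
qed

section \<open>Choice of parameters and the resulting exponent\<close>

theorem theorem5p1:
  fixes F :: "(real ^ 'd) set" and m k :: nat and \<epsilon> :: real
  assumes "1 \<le> m" and "m \<le> CARD('d)"
    and "k \<ge> 2"
    and "0 < \<epsilon>" and "\<epsilon> < 1 / sqrt (real CARD('d))"
    and "F \<noteq> {}"
    and "\<exists>E :: (real ^ 'd) set. orientation m E \<and> \<not> contains_AP k \<epsilon> E F"
  shows "assouad_dim F \<le> ereal (real CARD('d) +
           ln (1 - 1 / real k ^ m) /
           ln (real k * real_of_int \<lceil>sqrt (real CARD('d)) / (2 * \<epsilon>)\<rceil>))"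
proof -
  obtain E :: "(real ^ 'd) set" where E: "orientation m E" "\<not> contains_AP k \<epsilon> E F"
    using assms by blast
  then have cardE: "card E = m" by (simp add: orientation_def)
  obtain B where B: "E \<subseteq> B" "orthonormal_frame B"
    using orthonormal_frame_extension[of E] E(1) by (auto simp: orientation_def)
  \<comment> \<open>The ceiling is positive, so \<open>nat\<close> does not change its
    value.\<close>
  define N where "N = nat \<lceil>sqrt (real CARD('d)) / (2 * \<epsilon>)\<rceil>"
  have pos: "sqrt (real CARD('d)) / (2 * \<epsilon>) > 0" using \<open>0 < \<epsilon>\<close> by simp
  have N: "sqrt (real CARD('d)) / (2 * \<epsilon>) \<le> real N" "N > 0"
    "real_of_int \<lceil>sqrt (real CARD('d)) / (2 * \<epsilon>)\<rceil> = real N"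
    using pos by (auto simp: N_def)
  define q where "q = k * N"
  have q: "q \<ge> 2" using N(2) \<open>k \<ge> 2\<close> by (cases N) (auto simp: q_def)
  define M where "M = real q ^ CARD('d) * (1 - 1 / real k ^ m)"
  have km: "real k ^ m \<ge> 2"
    using \<open>k \<ge> 2\<close> \<open>1 \<le> m\<close> self_le_power[of "real k" m] by linarith
  have "real k ^ m \<le> real q ^ CARD('d)"
  proof -
    have "real k ^ m \<le> real k ^ CARD('d)" using assms by (intro power_increasing) auto
    also have "\<dots> \<le> real q ^ CARD('d)"
      using N(2) by (intro power_mono) (auto simp: q_def simp flip: of_nat_mult)
    finally show ?thesis .
  qed
  \<comment> \<open>The left side is \<open>k ^ m - 1\<close>, at least 1. Hence
    \<open>M \<ge> 1\<close> and its logarithm \<open>s\<close> is nonnegative, as the definition of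
    the dimension demands of exponents.\<close>
  then have "real k ^ m * (1 - 1 / real k ^ m) \<le> M"
    unfolding M_def using km by (intro mult_right_mono) (auto simp: divide_le_eq_1)
  then have M: "M \<ge> 1" using km \<open>k \<ge> 2\<close> by (simp add: right_diff_distrib)
  define s where "s = log (real q) M"
  have s: "real q powr s = M" "s \<ge> 0"
    using q M by (auto simp: s_def)
  have "assouad_dim F \<le> ereal s"
  proof (rule assouad_dim_le_of_subdivision[OF B(2) q s(2)])
    fix t :: "real ^ 'd" and l :: real assume "l > 0"
    then show "real (card {j \<in> B \<rightarrow>\<^sub>E {..<q}.
        orthonormal_frame.cube B (orthonormal_frame.subcorner B t (l / q) j) (l / q) \<inter> F \<noteq> {}})
      \<le> real q powr s"
      using few_subcubes_meet[OF B(2,1) _ N(2) _ E(2) N(1) \<open>0 < \<epsilon>\<close>, of l t] \<open>k \<ge> 2\<close>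
      unfolding s(1) unfolding M_def q_def cardE by simp
  qed
  also have "s = real CARD('d) + ln (1 - 1 / real k ^ m) / ln (real q)"
  proof -
    have "ln M = real CARD('d) * ln (real q) + ln (1 - 1 / real k ^ m)"
      unfolding M_def using q km by (subst ln_mult) (auto simp: ln_realpow)
    then show ?thesis using q by (simp add: s_def log_def field_simps)
  qed
  finally show ?thesis unfolding N(3) q_def by simp
qed

end
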